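(* Let $H$ and $K$ be cancellative monoids. Then every isomorphism $f \colon \mathcal P_1(H) \to \mathcal P_1(K)$ maps $\mathcal P_{\mathrm{fin},1}(H)$ bijectively onto $\mathcal P_{\mathrm{fin},1}(K)$, and hence restricts to an isomorphism $\mathcal P_{\mathrm{fin},1}(H) \to \mathcal P_{\mathrm{fin},1}(K)$.
   Context: Monoids are written multiplicatively and are not assumed commutative. A monoid is cancellative if for each element $a$ both maps $x \mapsto xa$ and $x \mapsto ax$ are injective. For a monoid $H$ with identity $1_H$, $\mathcal P_1(H)$ denotes the family of all subsets (finite or infinite) of $H$ containing $1_H$, which is a monoid under setwise multiplication $XY := \{xy : x\in X,\ y\in Y\}$, with identity $\{1_H\}$; $\mathcal P_{\mathrm{fin},1}(H)$ denotes the submonoid of $\mathcal P_1(H)$ consisting of the finite subsets of $H$ containing $1_H$. An isomorphism is a bijective semigroup homomorphism. *)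

theory Defs
  imports "HOL-Algebra.Coset" "HOL-Algebra.Divisibility"
begin

definition power_monoid :: "('a, 'm) monoid_scheme \<Rightarrow> 'a set monoid"  (\<open>\<P>\<^sub>1\<close>)
  where "power_monoid H =
    \<lparr>carrier = {X. X \<subseteq> carrier H \<and> \<one>\<^bsub>H\<^esub> \<in> X}, mult = set_mult H, one = {\<one>\<^bsub>H\<^esub>}\<rparr>"

definition fin_power_monoid :: "('a, 'm) monoid_scheme \<Rightarrow> 'a set monoid"  (\<open>\<P>\<^sub>f\<^sub>i\<^sub>n\<^sub>,\<^sub>1\<close>)
  where "fin_power_monoid H =
    (power_monoid H)\<lparr>carrier := {X \<in> carrier (power_monoid H). finite X}\<rparr>"

lemma (in monoid) monoid_power_monoid: "monoid (\<P>\<^sub>1 G)"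
proof (rule monoidI)
  fix X Y
  assume "X \<in> carrier (\<P>\<^sub>1 G)" "Y \<in> carrier (\<P>\<^sub>1 G)"
  then show "X \<otimes>\<^bsub>\<P>\<^sub>1 G\<^esub> Y \<in> carrier (\<P>\<^sub>1 G)"
    by (force simp: power_monoid_def set_mult_def)
next
  show "\<one>\<^bsub>\<P>\<^sub>1 G\<^esub> \<in> carrier (\<P>\<^sub>1 G)"
    by (simp add: power_monoid_def)
next
  fix X Y Z
  assume "X \<in> carrier (\<P>\<^sub>1 G)" "Y \<in> carrier (\<P>\<^sub>1 G)" "Z \<in> carrier (\<P>\<^sub>1 G)"
  then have *: "X \<subseteq> carrier G" "Y \<subseteq> carrier G" "Z \<subseteq> carrier G"
    by (auto simp: power_monoid_def)
  have "(x \<otimes> y) \<otimes> z = x \<otimes> (y \<otimes> z)" if "x \<in> X" "y \<in> Y" "z \<in> Z" for x y z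
    using that * by (intro m_assoc) auto
  then show "X \<otimes>\<^bsub>\<P>\<^sub>1 G\<^esub> Y \<otimes>\<^bsub>\<P>\<^sub>1 G\<^esub> Z = X \<otimes>\<^bsub>\<P>\<^sub>1 G\<^esub> (Y \<otimes>\<^bsub>\<P>\<^sub>1 G\<^esub> Z)"
    by (simp add: power_monoid_def set_mult_def)
next
  fix X
  assume "X \<in> carrier (\<P>\<^sub>1 G)"
  then have X: "X \<subseteq> carrier G"
    by (simp add: power_monoid_def)
  then have "\<one> \<otimes> x = x" "x \<otimes> \<one> = x" if "x \<in> X" for x
    using that by auto
  then show "\<one>\<^bsub>\<P>\<^sub>1 G\<^esub> \<otimes>\<^bsub>\<P>\<^sub>1 G\<^esub> X = X" "X \<otimes>\<^bsub>\<P>\<^sub>1 G\<^esub> \<one>\<^bsub>\<P>\<^sub>1 G\<^esub> = X"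
    by (simp_all add: power_monoid_def set_mult_def)
qed

lemma (in monoid) submonoid_fin_power_monoid:
  "submonoid (carrier (\<P>\<^sub>f\<^sub>i\<^sub>n\<^sub>,\<^sub>1 G)) (\<P>\<^sub>1 G)"
proof
  show "carrier (\<P>\<^sub>f\<^sub>i\<^sub>n\<^sub>,\<^sub>1 G) \<subseteq> carrier (\<P>\<^sub>1 G)"
    by (auto simp: fin_power_monoid_def)
  show "\<one>\<^bsub>\<P>\<^sub>1 G\<^esub> \<in> carrier (\<P>\<^sub>f\<^sub>i\<^sub>n\<^sub>,\<^sub>1 G)"
    by (simp add: fin_power_monoid_def power_monoid_def)
next
  fix X Y
  assume XY: "X \<in> carrier (\<P>\<^sub>f\<^sub>i\<^sub>n\<^sub>,\<^sub>1 G)" "Y \<in> carrier (\<P>\<^sub>f\<^sub>i\<^sub>n\<^sub>,\<^sub>1 G)"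
  then have "X \<otimes>\<^bsub>\<P>\<^sub>1 G\<^esub> Y \<in> carrier (\<P>\<^sub>1 G)"
    by (intro monoid.m_closed[OF monoid_power_monoid]) (auto simp: fin_power_monoid_def)
  moreover have "finite (X \<otimes>\<^bsub>\<P>\<^sub>1 G\<^esub> Y)"
    using XY by (simp add: fin_power_monoid_def power_monoid_def set_mult_def)
  ultimately show "X \<otimes>\<^bsub>\<P>\<^sub>1 G\<^esub> Y \<in> carrier (\<P>\<^sub>f\<^sub>i\<^sub>n\<^sub>,\<^sub>1 G)"
    by (simp add: fin_power_monoid_def)
qed

end

theory Submission
  imports Defs
begin

text \<open>
  Finiteness of a set \<open>X\<close> can be read off from the multiplication of the power monoid alone:
  \<open>X\<close> is finite if and only if its cube \<open>X X X\<close> has only finitely many left divisors.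

  A divisor of a set in the power monoid is a subset of it, because the cofactor contains the
  identity; so a finite set, and in particular the cube of a finite set, has finitely many
  divisors. Conversely, cancellativity leaves so much room in the cube that any single
  non-identity element \<open>x\<close> of \<open>X\<close> can be deleted from the factor \<open>X X\<close> without changing the
  product with \<open>X\<close>. If \<open>X\<close> is infinite, this gives infinitely many divisors of the cube. The
  square would not do: if \<open>X\<close> consists of the identity and the free generators of a free monoid,
  nothing can be deleted from either factor of \<open>X X\<close>.

  An isomorphism of monoids matches the divisors of an element with the divisors of its image,
  and therefore matches finite sets with finite sets.
\<close>

lemma carrier_power_monoid [simp]:
  "X \<in> carrier (\<P>\<^sub>1 G) \<longleftrightarrow> X \<subseteq> carrier G \<and> \<one>\<^bsub>G\<^esub> \<in> X"
  by (simp add: power_monoid_def)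

lemma mult_power_monoid [simp]: "X \<otimes>\<^bsub>\<P>\<^sub>1 G\<^esub> Y = X <#>\<^bsub>G\<^esub> Y"
  by (simp add: power_monoid_def)

lemma carrier_fin_power_monoid [simp]:
  "X \<in> carrier (\<P>\<^sub>f\<^sub>i\<^sub>n\<^sub>,\<^sub>1 G) \<longleftrightarrow> X \<in> carrier (\<P>\<^sub>1 G) \<and> finite X"
  by (simp add: fin_power_monoid_def)

lemma mult_fin_power_monoid [simp]: "X \<otimes>\<^bsub>\<P>\<^sub>f\<^sub>i\<^sub>n\<^sub>,\<^sub>1 G\<^esub> Y = X <#>\<^bsub>G\<^esub> Y"
  by (simp add: fin_power_monoid_def)

lemma (in monoid) divides_power_monoid_imp_subset:
  assumes "A \<in> carrier (\<P>\<^sub>1 G)" and "A divides\<^bsub>\<P>\<^sub>1 G\<^esub> Z"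
  shows "A \<subseteq> Z"
proof
  fix a assume "a \<in> A"
  moreover obtain B where "B \<in> carrier (\<P>\<^sub>1 G)" "Z = A <#> B"
    using assms(2) by (auto simp: factor_def)
  ultimately have "a \<otimes> \<one> \<in> Z"
    by (auto simp: set_mult_def)
  moreover have "a \<in> carrier G"
    using \<open>a \<in> A\<close> assms(1) by auto
  ultimately show "a \<in> Z"
    by simp
qed

text \<open>
  A product that uses the deleted element \<open>x\<close> as its left factor can be refactored: \<open>x \<one>\<close> is
  \<open>\<one> x\<close>, and for \<open>y \<noteq> \<one>\<close> the product \<open>x y\<close> is \<open>(x y) \<one>\<close>, where \<open>x y\<close> lies in the square and
  differs from \<open>x\<close> by cancellation.
\<close>

lemma (in monoid_cancel) square_minus_element_times_set:
  assumes X: "X \<subseteq> carrier G" "\<one> \<in> X" and x: "x \<in> X" "x \<noteq> \<one>"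
  shows "((X <#> X) - {x}) <#> X = (X <#> X) <#> X"
proof
  show "((X <#> X) - {x}) <#> X \<subseteq> (X <#> X) <#> X"
    by (auto simp: set_mult_def)
next
  show "(X <#> X) <#> X \<subseteq> ((X <#> X) - {x}) <#> X"
  proof
    fix z assume "z \<in> (X <#> X) <#> X"
    then obtain w y where w: "w \<in> X <#> X" and y: "y \<in> X" and z: "z = w \<otimes> y"
      by (auto simp: set_mult_def)
    have xG: "x \<in> carrier G" and yG: "y \<in> carrier G"
      using X x y by auto
    have "\<exists>v \<in> (X <#> X) - {x}. \<exists>u \<in> X. z = v \<otimes> u"
    proof (cases "w = x")
      case False
      then show ?thesis using w y z by blast
    next
      case wx: True
      show ?thesis
      proof (cases "y = \<one>")
        case True
        have "\<one> \<otimes> \<one> \<in> X <#> X"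
          using X(2) unfolding set_mult_def by blast
        then have "\<one> \<in> (X <#> X) - {x}" using x by simp
        moreover have "z = \<one> \<otimes> x" using True wx z xG by simp
        ultimately show ?thesis using x by blast
      next
        case False
        have "x \<otimes> y \<noteq> x \<otimes> \<one>"
          using False xG yG l_cancel[of x y \<one>] by blast
        moreover have "x \<otimes> y \<in> X <#> X"
          using x y unfolding set_mult_def by blast
        ultimately have "x \<otimes> y \<in> (X <#> X) - {x}" using xG by simp
        moreover have "z = (x \<otimes> y) \<otimes> \<one>" using wx z xG yG by simp
        ultimately show ?thesis using X(2) by blast
      qed
    qed
    then show "z \<in> ((X <#> X) - {x}) <#> X"
      unfolding set_mult_def by blast
  qed
qed

lemma (in monoid_cancel) finite_iff_finite_divisors_cube:
  assumes X: "X \<in> carrier (\<P>\<^sub>1 G)"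
  shows "finite X \<longleftrightarrow>
    finite {A \<in> carrier (\<P>\<^sub>1 G). A divides\<^bsub>\<P>\<^sub>1 G\<^esub> (X \<otimes>\<^bsub>\<P>\<^sub>1 G\<^esub> X) \<otimes>\<^bsub>\<P>\<^sub>1 G\<^esub> X}"
    (is "_ \<longleftrightarrow> finite ?D")
proof
  assume "finite X"
  then have "finite ((X <#> X) <#> X)"
    by (simp add: set_mult_def)
  moreover have "?D \<subseteq> Pow ((X <#> X) <#> X)"
    using divides_power_monoid_imp_subset by auto
  ultimately show "finite ?D"
    by (meson finite_Pow_iff finite_subset)
next
  assume fin: "finite ?D"
  have XG: "X \<subseteq> carrier G" and oneX: "\<one> \<in> X"
    using X by auto
  have XX: "X <#> X \<subseteq> carrier G"
    using XG by (rule set_mult_closed[OF _ XG])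
  have sub: "y \<in> X <#> X" if "y \<in> X" for y
  proof -
    have "y \<otimes> \<one> \<in> X <#> X"
      using that oneX unfolding set_mult_def by blast
    then show ?thesis using that XG by auto
  qed
  have "(\<lambda>x. (X <#> X) - {x}) ` (X - {\<one>}) \<subseteq> ?D"
  proof (rule image_subsetI)
    fix x assume x: "x \<in> X - {\<one>}"
    have "(X <#> X) - {x} \<in> carrier (\<P>\<^sub>1 G)"
      using XX sub[OF oneX] x by auto
    moreover have "(X <#> X) <#> X = ((X <#> X) - {x}) <#> X"
      using square_minus_element_times_set[OF XG oneX] x by simp
    then have "((X <#> X) - {x}) divides\<^bsub>\<P>\<^sub>1 G\<^esub> ((X <#> X) <#> X)"
      using X unfolding factor_def mult_power_monoid by blast
    ultimately show "(X <#> X) - {x} \<in> ?D" by simp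
  qed
  moreover have "inj_on (\<lambda>x. (X <#> X) - {x}) (X - {\<one>})"
    using sub by (intro inj_onI) blast
  ultimately have "finite (X - {\<one>})"
    using fin by (meson finite_imageD finite_subset)
  then show "finite X" by simp
qed

lemma iso_divides_iff:
  assumes f: "f \<in> iso M N" and M: "monoid M"
    and a: "a \<in> carrier M" and b: "b \<in> carrier M"
  shows "f a divides\<^bsub>N\<^esub> f b \<longleftrightarrow> a divides\<^bsub>M\<^esub> b"
proof -
  have hom: "f (u \<otimes>\<^bsub>M\<^esub> v) = f u \<otimes>\<^bsub>N\<^esub> f v"
    if "u \<in> carrier M" "v \<in> carrier M" for u v
    using f that by (auto simp: iso_def hom_def)
  have inj: "inj_on f (carrier M)" and img: "f ` carrier M = carrier N"
    using f by (auto simp: iso_def bij_betw_def)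
  have "f a divides\<^bsub>N\<^esub> f b \<longleftrightarrow> (\<exists>c \<in> carrier M. f b = f (a \<otimes>\<^bsub>M\<^esub> c))"
    unfolding factor_def img[symmetric] using a hom by auto
  also have "\<dots> \<longleftrightarrow> a divides\<^bsub>M\<^esub> b"
    using inj_on_eq_iff[OF inj b] monoid.m_closed[OF M a] by (auto simp: factor_def)
  finally show ?thesis .
qed

lemma iso_image_divisors:
  assumes f: "f \<in> iso M N" and M: "monoid M" and z: "z \<in> carrier M"
  shows "f ` {a \<in> carrier M. a divides\<^bsub>M\<^esub> z} = {b \<in> carrier N. b divides\<^bsub>N\<^esub> f z}"
proof -
  have img: "f ` carrier M = carrier N"
    using f by (auto simp: iso_def bij_betw_def)
  show ?thesis
    unfolding img[symmetric] using iso_divides_iff[OF f M _ z] by auto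
qed

lemma iso_power_monoid_finite_iff:
  assumes H: "monoid_cancel H" and K: "monoid_cancel K"
    and f: "f \<in> iso (\<P>\<^sub>1 H) (\<P>\<^sub>1 K)" and X: "X \<in> carrier (\<P>\<^sub>1 H)"
  shows "finite (f X) \<longleftrightarrow> finite X"
proof -
  define cube where "cube = (X \<otimes>\<^bsub>\<P>\<^sub>1 H\<^esub> X) \<otimes>\<^bsub>\<P>\<^sub>1 H\<^esub> X"
  define D where "D = {A \<in> carrier (\<P>\<^sub>1 H). A divides\<^bsub>\<P>\<^sub>1 H\<^esub> cube}"
  have mon: "monoid (\<P>\<^sub>1 H)"
    using H by (intro monoid.monoid_power_monoid monoid_cancel.axioms(1))
  have inj: "inj_on f (carrier (\<P>\<^sub>1 H))" and fX: "f X \<in> carrier (\<P>\<^sub>1 K)"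
    using f X by (auto simp only: iso_def bij_betw_def)
  have square: "X \<otimes>\<^bsub>\<P>\<^sub>1 H\<^esub> X \<in> carrier (\<P>\<^sub>1 H)"
    by (rule monoid.m_closed[OF mon X X])
  have cube: "cube \<in> carrier (\<P>\<^sub>1 H)"
    unfolding cube_def by (rule monoid.m_closed[OF mon square X])
  have fhom: "f \<in> hom (\<P>\<^sub>1 H) (\<P>\<^sub>1 K)"
    using f by (simp add: iso_def)
  have "f cube = (f X \<otimes>\<^bsub>\<P>\<^sub>1 K\<^esub> f X) \<otimes>\<^bsub>\<P>\<^sub>1 K\<^esub> f X"
    unfolding cube_def by (simp only: hom_mult[OF fhom square X] hom_mult[OF fhom X X])
  then have "finite (f X) \<longleftrightarrow> finite {B \<in> carrier (\<P>\<^sub>1 K). B divides\<^bsub>\<P>\<^sub>1 K\<^esub> f cube}"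
    using monoid_cancel.finite_iff_finite_divisors_cube[OF K fX] by (simp only:)
  also have "\<dots> \<longleftrightarrow> finite (f ` D)"
    unfolding D_def by (simp only: iso_image_divisors[OF f mon cube])
  also have "\<dots> \<longleftrightarrow> finite D"
    by (rule finite_image_iff, rule inj_on_subset[OF inj]) (auto simp only: D_def)
  also have "\<dots> \<longleftrightarrow> finite X"
    unfolding D_def cube_def
    by (rule monoid_cancel.finite_iff_finite_divisors_cube[OF H X, symmetric])
  finally show ?thesis .
qed

theorem theorem2p3:
  fixes H :: "('a, 'm) monoid_scheme"
    and K :: "('b, 'n) monoid_scheme"
    and f :: "'a set \<Rightarrow> 'b set"
  assumes "monoid_cancel H"
    and "monoid_cancel K"
    and "f \<in> iso (\<P>\<^sub>1 H) (\<P>\<^sub>1 K)"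
  shows "bij_betw f (carrier (\<P>\<^sub>f\<^sub>i\<^sub>n\<^sub>,\<^sub>1 H)) (carrier (\<P>\<^sub>f\<^sub>i\<^sub>n\<^sub>,\<^sub>1 K)) \<and>
    restrict f (carrier (\<P>\<^sub>f\<^sub>i\<^sub>n\<^sub>,\<^sub>1 H)) \<in> iso (\<P>\<^sub>f\<^sub>i\<^sub>n\<^sub>,\<^sub>1 H) (\<P>\<^sub>f\<^sub>i\<^sub>n\<^sub>,\<^sub>1 K)"
proof -
  let ?F = "carrier (\<P>\<^sub>f\<^sub>i\<^sub>n\<^sub>,\<^sub>1 H)" and ?E = "carrier (\<P>\<^sub>f\<^sub>i\<^sub>n\<^sub>,\<^sub>1 K)"
  have inj: "inj_on f (carrier (\<P>\<^sub>1 H))" and img: "f ` carrier (\<P>\<^sub>1 H) = carrier (\<P>\<^sub>1 K)"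
    and hom: "f \<in> hom (\<P>\<^sub>1 H) (\<P>\<^sub>1 K)"
    using assms(3) by (auto simp only: iso_def bij_betw_def)
  note fin = iso_power_monoid_finite_iff[OF assms]
  have F: "?F = {X \<in> carrier (\<P>\<^sub>1 H). finite X}" and E: "?E = {Y \<in> f ` carrier (\<P>\<^sub>1 H). finite Y}"
    unfolding img by (simp_all add: fin_power_monoid_def)
  have "f ` ?F = ?E"
    unfolding F E using fin by blast
  moreover have "inj_on f ?F"
    by (rule inj_on_subset[OF inj]) (auto simp only: F)
  ultimately have bij: "bij_betw f ?F ?E"
    by (simp add: bij_betw_def)
  have "restrict f ?F \<in> hom (\<P>\<^sub>f\<^sub>i\<^sub>n\<^sub>,\<^sub>1 H) (\<P>\<^sub>f\<^sub>i\<^sub>n\<^sub>,\<^sub>1 K)"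
  proof (rule homI)
    fix X assume "X \<in> ?F"
    then show "restrict f ?F X \<in> ?E"
      using bij by (auto simp only: restrict_apply bij_betw_def if_True)
  next
    fix X Y assume XY: "X \<in> ?F" "Y \<in> ?F"
    have "monoid H"
      using assms(1) by (rule monoid_cancel.axioms(1))
    then have "X \<otimes>\<^bsub>\<P>\<^sub>1 H\<^esub> Y \<in> ?F"
      using XY by (intro submonoid.m_closed[OF monoid.submonoid_fin_power_monoid])
    then have "X <#>\<^bsub>H\<^esub> Y \<in> ?F"
      by (simp only: mult_power_monoid)
    moreover have "f (X <#>\<^bsub>H\<^esub> Y) = f X <#>\<^bsub>K\<^esub> f Y"
      using hom_mult[OF hom, of X Y] XY by simp
    ultimately show "restrict f ?F (X \<otimes>\<^bsub>\<P>\<^sub>f\<^sub>i\<^sub>n\<^sub>,\<^sub>1 H\<^esub> Y)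
        = restrict f ?F X \<otimes>\<^bsub>\<P>\<^sub>f\<^sub>i\<^sub>n\<^sub>,\<^sub>1 K\<^esub> restrict f ?F Y"
      using XY by (simp only: mult_fin_power_monoid restrict_apply if_True)
  qed
  moreover have "bij_betw (restrict f ?F) ?F ?E"
    using bij by (simp only: bij_betw_restrict_eq)
  ultimately show ?thesis
    using bij by (simp add: iso_def)
qed

end
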